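(* Let $\mathcal{B}$ be a reflexive Banach space and let $\mathcal{B}_0\subseteq\mathcal{B}$ be a compact convex set. Consider the optimization problem $$\min_{f\in\mathcal{B}_0}\mathsf{L}(f).$$ Assume that the loss functional $\mathsf{L}:\mathcal{B}\to\mathbb{R}$ is convex and $L$-Lipschitz with respect to $\|\cdot\|_{\mathcal{B}}$. Let $\mathcal{C}\subseteq\mathcal{B}$ be a convex set whose closure contains $\mathcal{B}_0$, and assume that there exists a proper mirror map $\Phi:\mathcal{C}\to\mathbb{R}$ that is Gâteaux differentiable and $\mu$-strongly convex over $\mathcal{C}\cap\mathcal{B}_0$ with respect to $\|\cdot\|_{\mathcal{B}}$. Let $R^2=\max_{f,f'\in\mathcal{B}_0\cap\mathcal{C}}|\Phi(f)-\Phi(f')|$. Then there is a choice of the learning rate $\eta$ such that the projected mirror descent algorithm $$g_t\leftarrow g_{t-1}-\eta\,\partial_{f_{t-1}}\mathsf{L},\qquad f_t\leftarrow\Pi^{\Phi}_{\mathcal{B}_0}\big((\partial\Phi)^{-1}(g_t)\big)$$ converges to the optimal solution in $\mathcal{B}_0$ at the rate $\tilde O\big(\tfrac{1}{\sqrt t}\big)$, where $t$ is the number of iterations.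
   Context: $\mathcal{B}^*$ is the dual Banach space of $\mathcal{B}$, and $\langle f,g\rangle_{\mathcal{B}}=g(f)$ for $f\in\mathcal{B}$, $g\in\mathcal{B}^*$. The set of subgradients of a functional $\mathsf{F}$ at $f_0$ is $\partial_{f_0}\mathsf{F}=\{g\in\mathcal{B}^*:\ \mathsf{F}(f)\ge\mathsf{F}(f_0)+\langle f-f_0,g\rangle_{\mathcal{B}}\ \text{for all } f\}$. In the algorithm, $\partial_{f_{t-1}}\mathsf{L}$ stands for a chosen subgradient of $\mathsf{L}$ at $f_{t-1}$ (no differentiability of $\mathsf{L}$ is assumed), $g_t\in\mathcal{B}^*$ are the dual iterates started from an initial $g_0$, and $f_t$ are the primal iterates, with $f_0$ obtained from $g_0$ in the same way as $f_t$ from $g_t$. The optimal solution is a minimizer $f^*$ of $\mathsf{L}$ over $\mathcal{B}_0$; the rate of convergence refers to the optimality gap in the value of $\mathsf{L}$ relative to $\mathsf{L}(f^* )$. A functional is proper if its domain is nonempty and it never takes the value $-\infty$. A convex functional $\mathsf{L}$ is $L$-Lipschitz with respect to $\|\cdot\|_{\mathcal{B}}$ if $\|g\|_{\mathcal{B}^*}\le L$ for all $f\in\mathcal{B}$ and all $g\in\partial_f\mathsf{L}$. $\Phi$ is $\mu$-strongly convex ($\mu>0$) over $\mathcal{C}\cap\mathcal{B}_0$ if for every $f_0$ in this set there is $g\in\partial_{f_0}\Phi$ with $\Phi(f)-\Phi(f_0)\ge\langle f-f_0,g\rangle_{\mathcal{B}}+\frac{\mu}{2}\|f-f_0\|_{\mathcal{B}}^2$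 for all $f$ in this set. A mirror map $\Phi:\mathcal{C}\to\mathbb{R}$ is a strictly convex functional whose subgradient sets at distinct points are disjoint and whose subgradients over $\mathcal{C}$ fill the dual space, $\partial_{(\cdot)}\Phi(\mathcal{C})=\mathcal{B}^*$; $(\partial\Phi)^{-1}(g)$ denotes the point whose (sub)gradient is $g$. The Bregman divergence is $\mathfrak{D}_\Phi(f,f')=\Phi(f)-\Phi(f')-\langle f-f',\partial_{f'}\Phi\rangle_{\mathcal{B}}$. The projection map is $\Pi^\Phi_{\mathcal{B}_0}(f')=\arg\min_{f\in\mathcal{B}_0\cap\mathcal{C}}\mathfrak{D}_\Phi(f,f')$ for $f'\in\mathcal{C}$. To avoid cases where this argmin is empty, it is further assumed that $\|\partial_f\Phi\|_{\mathcal{B}^*}\to+\infty$ as $f$ tends to the boundary of $\mathcal{C}$. *)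

theory Defs
  imports "HOL-Analysis.Analysis" "HOL-Library.Landau_Symbols"
begin

text \<open>
  The dual space is the library's Banach space of bounded linear functionals; the pairing of
  \<open>f\<close> with \<open>g\<close> is \<open>blinfun_apply g f\<close>, and \<open>norm g\<close> is the dual (operator) norm.
\<close>

type_synonym 'a dual = "'a \<Rightarrow>\<^sub>L real"

definition reflexive_space :: "'a::real_normed_vector itself \<Rightarrow> bool" where
  "reflexive_space _ \<longleftrightarrow>
     (\<forall>F :: 'a dual dual. \<exists>x :: 'a. \<forall>g :: 'a dual. blinfun_apply F g = blinfun_apply g x)"

text \<open>
  A real-valued functional with domain \<open>C\<close> is a total function of which only the values on \<open>C\<close>
  matter; it stands for its extension by \<open>\<infinity>\<close> outside \<open>C\<close>. Hence the subgradient inequality is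
  only a condition at points of \<open>C\<close>, and properness amounts to \<open>C \<noteq> {}\<close>.
\<close>

definition subgradients :: "'a::real_normed_vector set \<Rightarrow> ('a \<Rightarrow> real) \<Rightarrow> 'a \<Rightarrow> 'a dual set" where
  "subgradients C F f0 = {g. \<forall>f\<in>C. F f \<ge> F f0 + blinfun_apply g (f - f0)}"

definition lipschitz_functional :: "real \<Rightarrow> ('a::real_normed_vector \<Rightarrow> real) \<Rightarrow> bool" where
  "lipschitz_functional L F \<longleftrightarrow> (\<forall>f. \<forall>g\<in>subgradients UNIV F f. norm g \<le> L)"

definition strictly_convex_on :: "'a::real_vector set \<Rightarrow> ('a \<Rightarrow> real) \<Rightarrow> bool" where
  "strictly_convex_on C F \<longleftrightarrow> convex C \<and>
     (\<forall>x\<in>C. \<forall>y\<in>C. \<forall>t::real. x \<noteq> y \<and> 0 < t \<and> t < 1 \<longrightarrow>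
        F ((1 - t) *\<^sub>R x + t *\<^sub>R y) < (1 - t) * F x + t * F y)"

text \<open>Strong convexity over \<open>S\<close> of a functional whose domain is \<open>C\<close>.\<close>

definition strongly_convex_over ::
  "real \<Rightarrow> 'a::real_normed_vector set \<Rightarrow> 'a set \<Rightarrow> ('a \<Rightarrow> real) \<Rightarrow> bool" where
  "strongly_convex_over \<mu> S C F \<longleftrightarrow>
     (\<forall>f0\<in>S. \<exists>g\<in>subgradients C F f0. \<forall>f\<in>S.
        F f - F f0 \<ge> blinfun_apply g (f - f0) + \<mu> / 2 * (norm (f - f0))\<^sup>2)"

text \<open>
  The two-sided directional derivatives only make sense if \<open>F\<close> is defined at \<open>f + t h\<close> for
  all small \<open>t\<close>, which is therefore part of the definition.
\<close>

definition has_gateaux_derivative ::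
  "'a::real_normed_vector set \<Rightarrow> ('a \<Rightarrow> real) \<Rightarrow> 'a \<Rightarrow> 'a dual \<Rightarrow> bool" where
  "has_gateaux_derivative C F f g \<longleftrightarrow>
     (\<forall>h. (\<forall>\<^sub>F t::real in at 0. f + t *\<^sub>R h \<in> C) \<and>
          ((\<lambda>t::real. (F (f + t *\<^sub>R h) - F f) / t) \<longlongrightarrow> blinfun_apply g h) (at 0))"

definition gateaux_differentiable_on ::
  "'a::real_normed_vector set \<Rightarrow> ('a \<Rightarrow> real) \<Rightarrow> bool" where
  "gateaux_differentiable_on C F \<longleftrightarrow> (\<forall>f\<in>C. \<exists>g. has_gateaux_derivative C F f g)"

definition mirror_map :: "'a::real_normed_vector set \<Rightarrow> ('a \<Rightarrow> real) \<Rightarrow> bool" where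
  "mirror_map C \<Phi> \<longleftrightarrow> strictly_convex_on C \<Phi> \<and>
     (\<forall>f\<in>C. \<forall>f'\<in>C. f \<noteq> f' \<longrightarrow> subgradients C \<Phi> f \<inter> subgradients C \<Phi> f' = {}) \<and>
     (\<Union>f\<in>C. subgradients C \<Phi> f) = UNIV"

text \<open>
  At a point of Gateaux differentiability of a convex functional the subgradient set is a
  singleton, so that \<open>THE\<close> is determined.
\<close>

definition mirror_grad :: "'a::real_normed_vector set \<Rightarrow> ('a \<Rightarrow> real) \<Rightarrow> 'a \<Rightarrow> 'a dual" where
  "mirror_grad C \<Phi> f = (THE g. g \<in> subgradients C \<Phi> f)"

definition mirror_inv :: "'a::real_normed_vector set \<Rightarrow> ('a \<Rightarrow> real) \<Rightarrow> 'a dual \<Rightarrow> 'a" where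
  "mirror_inv C \<Phi> g = (THE f. f \<in> C \<and> g \<in> subgradients C \<Phi> f)"

definition grad_blowup_at_boundary :: "'a::real_normed_vector set \<Rightarrow> ('a \<Rightarrow> real) \<Rightarrow> bool" where
  "grad_blowup_at_boundary C \<Phi> \<longleftrightarrow>
     (\<forall>p\<in>frontier C. filterlim (\<lambda>f. norm (mirror_grad C \<Phi> f)) at_top (at p within C))"

definition bregman :: "'a::real_normed_vector set \<Rightarrow> ('a \<Rightarrow> real) \<Rightarrow> 'a \<Rightarrow> 'a \<Rightarrow> real" where
  "bregman C \<Phi> f f' = \<Phi> f - \<Phi> f' - blinfun_apply (mirror_grad C \<Phi> f') (f - f')"

definition bregman_proj ::
  "'a::real_normed_vector set \<Rightarrow> ('a \<Rightarrow> real) \<Rightarrow> 'a set \<Rightarrow> 'a \<Rightarrow> 'a" where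
  "bregman_proj C \<Phi> B0 f' = arg_min_on (\<lambda>f. bregman C \<Phi> f f') (B0 \<inter> C)"

text \<open>
  Dual iterates \<open>g\<close> and primal iterates \<open>f\<close> of projected mirror descent with learning rate
  \<open>\<eta>\<close>. The subgradient of the loss is chosen afresh in every step; nothing ties the choices at
  different steps together.
\<close>

definition projected_mirror_descent ::
  "('a::real_normed_vector \<Rightarrow> real) \<Rightarrow> 'a set \<Rightarrow> ('a \<Rightarrow> real) \<Rightarrow> 'a set \<Rightarrow> real \<Rightarrow>
   (nat \<Rightarrow> 'a dual) \<Rightarrow> (nat \<Rightarrow> 'a) \<Rightarrow> bool" where
  "projected_mirror_descent Loss C \<Phi> B0 \<eta> g f \<longleftrightarrow>
     (\<forall>t. f t = bregman_proj C \<Phi> B0 (mirror_inv C \<Phi> (g t))) \<and>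
     (\<forall>t. \<exists>s\<in>subgradients UNIV Loss (f t). g (Suc t) = g t - \<eta> *\<^sub>R s)"

text \<open>The class usually written with a tilde over the \<open>O\<close>: logarithmic factors are ignored.\<close>

definition soft_bigo :: "(nat \<Rightarrow> real) \<Rightarrow> (nat \<Rightarrow> real) set" where
  "soft_bigo b = {r. \<exists>k::nat. r \<in> O(\<lambda>n. b n * ln (real n) ^ k)}"

end

theory Submission
  imports Defs "HOL-Real_Asymp.Real_Asymp"
begin

text \<open>
  The iterate \<open>f\<^sub>t\<close> minimizes \<open>\<Phi> - g\<^sub>t\<close> over \<open>B0 \<inter> C\<close>, and the gap
  \<open>V\<^sub>t(u) = (\<Phi> - g\<^sub>t)(u) - (\<Phi> - g\<^sub>t)(f\<^sub>t)\<close> satisfies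
  \<open>V\<^sub>t\<^sub>+\<^sub>1(u) \<le> V\<^sub>t(u) - \<eta> (Loss(f\<^sub>t) - Loss(u)) + \<eta>\<^sup>2 L\<^sup>2 / 2\<mu>\<close>. Since \<open>V\<^sub>a(f\<^sub>a) = 0\<close>, the regret over the
  steps \<open>a, \<dots>, T\<close> against \<open>f\<^sub>a\<close> itself is at most \<open>\<eta> L\<^sup>2 / 2\<mu>\<close> per step; averaging these
  bounds over suffixes (Shamir and Zhang) shows that the last iterate is worse than the average of
  all iterates only by a harmonic sum times \<open>\<eta> L\<^sup>2 / 2\<mu>\<close>. The horizon-dependent rate is
  \<open>\<eta> = 1 / \<surd>(T + 1)\<close>. The optimum may lie outside \<open>C\<close> and is approached from \<open>B0 \<inter> C\<close> along a
  segment, on which convexity (\<open>Loss\<close> need not be continuous) bounds \<open>Loss\<close>.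

  The minimizer exists because the gradient blows up at the boundary; this uses that \<open>C\<close> is open,
  which itself follows from the blow-up and Gateaux differentiability by a Baire category argument.
\<close>

section \<open>Segments, dual norms and subgradients\<close>

text \<open>Replacing \<open>p\<close> by a nearby point \<open>y\<close> of \<open>C\<close> is
  compensated by moving \<open>c\<close> to a point \<open>z\<close> that is still in a ball around
  \<open>c\<close> inside \<open>C\<close>.\<close>

lemma convex_open_closure_shrink:
  fixes C :: "'a::real_normed_vector set"
  assumes "convex C" "open C" "c \<in> C" "p \<in> closure C" "0 < e" "e \<le> 1"
  shows "p + e *\<^sub>R (c - p) \<in> C"
proof -
  obtain d where d: "d > 0" "ball c d \<subseteq> C"
    using assms(2,3) openE by blast
  have "e * d > 0" using d assms by simp
  then obtain y where y: "y \<in> C" "dist y p < e * d"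
    using assms(4) unfolding closure_approachable by blast
  define z where "z = c + ((1 - e) / e) *\<^sub>R (p - y)"
  have "dist c z = (1 - e) / e * dist y p"
    using assms by (simp add: z_def dist_norm norm_minus_commute)
  also have "\<dots> \<le> 1 / e * dist y p"
    using assms by (intro mult_right_mono divide_right_mono) auto
  also have "\<dots> < d"
    using y assms by (simp add: field_simps)
  finally have z: "z \<in> C" using d by auto
  have "e *\<^sub>R z = e *\<^sub>R c + (1 - e) *\<^sub>R (p - y)"
    using assms by (simp add: z_def scaleR_add_right)
  then have "p + e *\<^sub>R (c - p) = (1 - e) *\<^sub>R y + e *\<^sub>R z"
    by (simp add: algebra_simps)
  then show ?thesis
    using convexD_alt[OF assms(1) y(1) z] assms by simp
qed

text \<open>Turns a one-sided bound into a dual norm bound: test on both signs of the multiple of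
  \<open>x\<close> of length \<open>r / 2\<close>, which lies inside the open ball and causes the
  factor 2.\<close>

lemma norm_blinfun_le_of_bound_on_ball:
  fixes g :: "'a::real_normed_vector \<Rightarrow>\<^sub>L real"
  assumes "r > 0" and le: "\<And>w. norm w < r \<Longrightarrow> blinfun_apply g w \<le> K"
  shows "norm g \<le> 2 * K / r"
proof (rule norm_blinfun_bound)
  have "K \<ge> 0" using le[of 0] assms by simp
  then show "0 \<le> 2 * K / r" using assms by simp
  fix x
  show "norm (blinfun_apply g x) \<le> 2 * K / r * norm x"
  proof (cases "x = 0")
    case False
    define s where "s = r / (2 * norm x)"
    have s: "s > 0" using False assms by (simp add: s_def)
    have n: "norm (s *\<^sub>R x) < r" "norm ((- s) *\<^sub>R x) < r"
      using False assms s by (auto simp: s_def)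
    have "s * blinfun_apply g x \<le> K" "- (s * blinfun_apply g x) \<le> K"
      using le[OF n(1)] le[OF n(2)] by (simp_all add: blinfun.scaleR_right blinfun.minus_right)
    then have "s * \<bar>blinfun_apply g x\<bar> \<le> K" by (cases "blinfun_apply g x \<ge> 0") auto
    then show ?thesis using False assms by (simp add: s_def field_simps)
  qed simp
qed

lemma has_gateaux_derivative_at_right:
  assumes "has_gateaux_derivative C F f g"
  shows "((\<lambda>t. (F (f + t *\<^sub>R h) - F f) / t) \<longlongrightarrow> blinfun_apply g h) (at_right 0)"
  using assms filterlim_at_split unfolding has_gateaux_derivative_def by blast

lemma has_gateaux_derivative_radial:
  assumes "has_gateaux_derivative C F f g"
  obtains \<delta> where "\<delta> > 0" "\<And>t. \<bar>t\<bar> < \<delta> \<Longrightarrow> t \<noteq> 0 \<Longrightarrow> f + t *\<^sub>R h \<in> C"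
proof -
  have "\<forall>\<^sub>F t in at 0. f + t *\<^sub>R h \<in> C"
    using assms unfolding has_gateaux_derivative_def by blast
  then obtain \<delta> where "\<delta> > 0" "\<forall>t. t \<noteq> 0 \<and> dist t 0 < \<delta> \<longrightarrow> f + t *\<^sub>R h \<in> C"
    unfolding eventually_at by auto
  then show thesis by (intro that[of \<delta>]) auto
qed

text \<open>The subgradient inequality along \<open>f + t *\<^sub>R h\<close> bounds
  \<open>s\<close> by the derivative, and the direction \<open>- h\<close> turns this into equality.
  Conversely, convexity bounds the quotients towards \<open>y\<close> by
  \<open>F y - F f\<close>.\<close>

lemma subgradients_gateaux:
  assumes conv: "convex_on C F" and f: "f \<in> C" and g: "has_gateaux_derivative C F f g"
  shows "subgradients C F f = {g}"
proof (intro equalityI subsetI)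
  fix s assume s: "s \<in> subgradients C F f"
  have "blinfun_apply s h \<le> blinfun_apply g h" for h
  proof (rule tendsto_lowerbound[OF has_gateaux_derivative_at_right[OF g]])
    obtain \<delta> where \<delta>: "\<delta> > 0" "\<And>t. \<bar>t\<bar> < \<delta> \<Longrightarrow> t \<noteq> 0 \<Longrightarrow> f + t *\<^sub>R h \<in> C"
      using has_gateaux_derivative_radial[OF g] by blast
    have "blinfun_apply s h \<le> (F (f + t *\<^sub>R h) - F f) / t" if "0 < t" "t < \<delta>" for t
    proof -
      have "F (f + t *\<^sub>R h) \<ge> F f + blinfun_apply s (f + t *\<^sub>R h - f)"
        using s \<delta>(2)[of t] that unfolding subgradients_def by auto
      then show ?thesis using that by (simp add: blinfun.scaleR_right field_simps)
    qed
    then show "\<forall>\<^sub>F t in at_right 0. blinfun_apply s h \<le> (F (f + t *\<^sub>R h) - F f) / t"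
      using \<delta>(1) by (auto simp: eventually_at_right_field)
  qed simp
  from this this[of "- _"] have "blinfun_apply s h = blinfun_apply g h" for h
    by (metis antisym blinfun.minus_right neg_le_iff_le)
  then show "s \<in> {g}" by (simp add: blinfun_eqI)
next
  fix s assume "s \<in> {g}"
  have "F y \<ge> F f + blinfun_apply g (y - f)" if y: "y \<in> C" for y
  proof -
    have "blinfun_apply g (y - f) \<le> F y - F f"
    proof (rule tendsto_upperbound[OF has_gateaux_derivative_at_right[OF g]])
      have "(F (f + t *\<^sub>R (y - f)) - F f) / t \<le> F y - F f" if "0 < t" "t < 1" for t
      proof -
        have "f + t *\<^sub>R (y - f) = (1 - t) *\<^sub>R f + t *\<^sub>R y" by (simp add: algebra_simps)
        then have "F (f + t *\<^sub>R (y - f)) \<le> (1 - t) * F f + t * F y"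
          using convex_onD[OF conv, of t f y] that f y by simp
        then show ?thesis using that by (simp add: field_simps)
      qed
      then show "\<forall>\<^sub>F t in at_right 0. (F (f + t *\<^sub>R (y - f)) - F f) / t \<le> F y - F f"
        by (auto simp: eventually_at_right_field intro!: exI[of _ 1])
    qed simp
    then show ?thesis by simp
  qed
  then show "s \<in> subgradients C F f"
    using \<open>s \<in> {g}\<close> by (simp add: subgradients_def)
qed

lemma strictly_convex_on_imp_convex_on:
  assumes "strictly_convex_on C F" shows "convex_on C F"
proof (rule convex_onI)
  show "convex C" using assms by (simp add: strictly_convex_on_def)
  fix t x y assume "0 < t" "t < (1::real)" "x \<in> C" "y \<in> C"
  then show "F ((1 - t) *\<^sub>R x + t *\<^sub>R y) \<le> (1 - t) * F x + t * F y"
    using assms unfolding strictly_convex_on_def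
    by (cases "x = y") (auto simp: algebra_simps simp flip: scaleR_left_distrib intro: less_imp_le)
qed

section \<open>Openness of the domain of the mirror map\<close>

locale gateaux_convex =
  fixes C :: "'a::banach set" and \<Phi> :: "'a \<Rightarrow> real"
  assumes conv: "convex_on C \<Phi>"
    and gateaux: "gateaux_differentiable_on C \<Phi>"
    and blowup: "grad_blowup_at_boundary C \<Phi>"
begin

abbreviation D :: "'a \<Rightarrow> 'a dual" where "D \<equiv> mirror_grad C \<Phi>"

lemma convex_domain: "convex C"
  using conv by (rule convex_on_imp_convex)

lemma subgradients_eq: "f \<in> C \<Longrightarrow> subgradients C \<Phi> f = {D f}"
  using gateaux subgradients_gateaux[OF conv]
  unfolding gateaux_differentiable_on_def mirror_grad_def by fastforce

lemma has_gateaux_derivative_D: "f \<in> C \<Longrightarrow> has_gateaux_derivative C \<Phi> f (D f)"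
  using gateaux subgradients_gateaux[OF conv] subgradients_eq
  unfolding gateaux_differentiable_on_def by (metis singleton_inject)

lemma subgradient_ineq: "\<lbrakk>f \<in> C; y \<in> C\<rbrakk> \<Longrightarrow> \<Phi> f + blinfun_apply (D f) (y - f) \<le> \<Phi> y"
  using subgradients_eq[of f] unfolding subgradients_def by blast

text \<open>Every point of \<open>C\<close> is algebraically interior; the Baire argument upgrades
  this to topological openness.\<close>

lemma radial:
  assumes "f \<in> C"
  obtains \<delta> where "\<delta> > 0" "\<And>t. \<bar>t\<bar> < \<delta> \<Longrightarrow> f + t *\<^sub>R h \<in> C"
proof -
  obtain \<delta> where \<delta>: "\<delta> > 0" "\<And>t. \<bar>t\<bar> < \<delta> \<Longrightarrow> t \<noteq> 0 \<Longrightarrow> f + t *\<^sub>R h \<in> C"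
    using has_gateaux_derivative_radial[OF has_gateaux_derivative_D[OF assms]] by blast
  have "f + t *\<^sub>R h \<in> C" if "\<bar>t\<bar> < \<delta>" for t
    using \<delta>(2)[OF that] assms by (cases "t = 0") auto
  with \<delta>(1) show thesis by (rule that)
qed

text \<open>
  Baire category: the sets where all supporting affine functions are at most \<open>n\<close>, dilated from
  \<open>c\<close>, are closed and cover the space because \<open>C\<close> is absorbing at \<open>c\<close>.
\<close>

lemma supports_locally_bounded:
  assumes c: "c \<in> C"
  shows "\<exists>r>0. \<exists>M. \<forall>y\<in>C. \<forall>z\<in>ball c r. \<Phi> y + blinfun_apply (D y) (z - y) \<le> M"
proof -
  define Q where "Q = (\<lambda>(n::nat, k::nat).
    {h. \<forall>y\<in>C. \<Phi> y + blinfun_apply (D y) (c + (1 / real (Suc k)) *\<^sub>R h - y) \<le> real n})"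
  have clo: "closed (Q nk)" for nk
  proof -
    obtain n k where nk: "nk = (n, k)" by fastforce
    have "Q nk = (\<Inter>y\<in>C. {h. \<Phi> y + blinfun_apply (D y) (c + (1 / real (Suc k)) *\<^sub>R h - y) \<le> real n})"
      by (auto simp: Q_def nk)
    then show ?thesis
      by (auto intro!: closed_INT closed_Collect_le continuous_intros)
  qed
  have cover: "(\<Union>nk. Q nk) = UNIV"
  proof (intro equalityI subsetI UNIV_I)
    fix h
    obtain \<delta> where \<delta>: "\<delta> > 0" "\<And>t. \<bar>t\<bar> < \<delta> \<Longrightarrow> c + t *\<^sub>R h \<in> C"
      using radial[OF c] by blast
    obtain k where k: "1 / real (Suc k) < \<delta>"
      using \<delta>(1) nat_approx_posE by blast
    obtain n where n: "\<Phi> (c + (1 / real (Suc k)) *\<^sub>R h) \<le> real n"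
      using real_arch_simple by blast
    have "h \<in> Q (n, k)"
      using subgradient_ineq \<delta>(2)[of "1 / real (Suc k)"] k n unfolding Q_def
      by (auto intro: order_trans)
    then show "h \<in> (\<Union>nk. Q nk)" by blast
  qed
  have "\<exists>nk. interior (Q nk) \<noteq> {}"
  proof (rule ccontr)
    assume "\<not> ?thesis"
    then have "euclidean interior_of \<Union>(range Q) = {}"
      using clo by (intro Baire_category_alt disjI1 completely_metrizable_space_euclidean)
        (auto simp: euclidean_interior_of)
    then show False using cover by (simp add: euclidean_interior_of)
  qed
  then obtain n k h0 where "h0 \<in> interior (Q (n, k))" by auto
  then obtain \<rho> where \<rho>: "\<rho> > 0" "ball h0 \<rho> \<subseteq> Q (n, k)"
    by (auto simp: mem_interior)
  obtain \<delta> where \<delta>: "\<delta> > 0" "\<And>t. \<bar>t\<bar> < \<delta> \<Longrightarrow> c + t *\<^sub>R h0 \<in> C"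
    using radial[OF c] by blast
  define t where "t = \<delta> / 2"
  define \<kappa> where "\<kappa> = 1 / real (Suc k)"
  \<comment> \<open>With this weight \<open>c\<close> is the convex combination of
    \<open>c + \<kappa> *\<^sub>R h0\<close> and \<open>c - t *\<^sub>R h0\<close>, so the bound on
    a ball around the former carries over to a ball around \<open>c\<close>, scaled by
    \<open>\<theta>\<close>.\<close>
  define \<theta> where "\<theta> = t / (\<kappa> + t)"
  have t: "t > 0" "c - t *\<^sub>R h0 \<in> C" using \<delta>(1) \<delta>(2)[of "-t"] by (auto simp: t_def)
  have \<kappa>: "\<kappa> > 0" by (simp add: \<kappa>_def)
  have \<theta>: "\<theta> > 0" "\<theta> \<le> 1" "\<theta> * \<kappa> = (1 - \<theta>) * t" using t \<kappa> by (auto simp: \<theta>_def field_simps)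
  show ?thesis
  proof (intro exI conjI ballI)
    show "\<theta> * \<kappa> * \<rho> > 0" using \<theta>(1) \<kappa> \<rho>(1) by simp
    fix y z assume y: "y \<in> C" and z: "z \<in> ball c (\<theta> * \<kappa> * \<rho>)"
    define v where "v = (1 / (\<theta> * \<kappa>)) *\<^sub>R (z - c)"
    have "norm v = norm (z - c) / (\<theta> * \<kappa>)" using \<theta>(1) \<kappa> by (simp add: v_def)
    also have "\<dots> < \<rho>" using z \<theta>(1) \<kappa>
      by (simp add: dist_norm norm_minus_commute pos_divide_less_eq mult.commute)
    finally have "norm v < \<rho>" .
    then have "h0 + v \<in> Q (n, k)" using \<rho> by (intro set_mp[OF \<rho>(2)]) (simp add: dist_norm)
    then have 1: "\<Phi> y + blinfun_apply (D y) (c + \<kappa> *\<^sub>R (h0 + v) - y) \<le> real n"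
      using y by (simp add: Q_def \<kappa>_def)
    have 2: "\<Phi> y + blinfun_apply (D y) (c - t *\<^sub>R h0 - y) \<le> \<Phi> (c - t *\<^sub>R h0)"
      using subgradient_ineq[OF y t(2)] .
    have vz: "(\<theta> * \<kappa>) *\<^sub>R v = z - c" using \<theta>(1) \<kappa> by (simp add: v_def)
    have "z - y = \<theta> *\<^sub>R (c + \<kappa> *\<^sub>R (h0 + v) - y) + (1 - \<theta>) *\<^sub>R (c - t *\<^sub>R h0 - y)"
    proof -
      have "\<theta> *\<^sub>R (c + \<kappa> *\<^sub>R (h0 + v) - y) + (1 - \<theta>) *\<^sub>R (c - t *\<^sub>R h0 - y)
        = (c - y) + (\<theta> * \<kappa>) *\<^sub>R v + (\<theta> * \<kappa> - (1 - \<theta>) * t) *\<^sub>R h0"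
        by (simp add: algebra_simps)
      then show ?thesis using vz \<theta>(3) by simp
    qed
    then have "\<Phi> y + blinfun_apply (D y) (z - y)
      = \<theta> * (\<Phi> y + blinfun_apply (D y) (c + \<kappa> *\<^sub>R (h0 + v) - y))
        + (1 - \<theta>) * (\<Phi> y + blinfun_apply (D y) (c - t *\<^sub>R h0 - y))"
      by (simp only: blinfun.add_right blinfun.scaleR_right) (simp add: algebra_simps)
    also have "\<dots> \<le> \<theta> * real n + (1 - \<theta>) * \<Phi> (c - t *\<^sub>R h0)"
      using 1 2 \<theta> by (intro add_mono mult_left_mono) auto
    finally show "\<Phi> y + blinfun_apply (D y) (z - y) \<le> \<theta> * real n + (1 - \<theta>) * \<Phi> (c - t *\<^sub>R h0)" .
  qed
qed

text \<open>Such a \<open>p\<close> is a frontier point and a limit point of \<open>C\<close>, so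
  the blow-up at \<open>p\<close> is not vacuous.\<close>

lemma blowup_eventually:
  assumes "p \<in> closure C" "p \<notin> C"
  shows "\<forall>\<^sub>F f in at p within C. norm (D f) \<ge> K" and "at p within C \<noteq> bot"
proof -
  have "p \<in> frontier C" using assms interior_subset unfolding frontier_def by blast
  then show "\<forall>\<^sub>F f in at p within C. norm (D f) \<ge> K"
    using blowup unfolding grad_blowup_at_boundary_def filterlim_at_top by blast
  show "at p within C \<noteq> bot"
    using assms by (auto simp: closure_def trivial_limit_within)
qed

text \<open>
  Leaving \<open>C\<close> along a segment inside a ball on which the supporting functions are bounded would
  contradict the blow-up of the gradient at the exit point.
\<close>

lemma open_domain: "open C"
proof (rule openI)
  fix c assume c: "c \<in> C"
  obtain M r where r: "r > 0"
    and M: "\<And>y z. y \<in> C \<Longrightarrow> z \<in> ball c r \<Longrightarrow> \<Phi> y + blinfun_apply (D y) (z - y) \<le> M"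
    using supports_locally_bounded[OF c] by blast
  have "x \<in> C" if x: "x \<in> ball c r" for x
  proof (rule ccontr)
    assume xC: "x \<notin> C"
    define seg where "seg = (\<lambda>t. c + t *\<^sub>R (x - c))"
    define T where "T = {t \<in> {0..1}. seg t \<in> C}"
    define p where "p = seg (Sup T)"
    have T: "0 \<in> T" "bdd_above T"
      using c by (auto simp: T_def seg_def intro: bdd_aboveI[of _ 1])
    then have T_ne: "T \<noteq> {}" by blast
    have Sup: "0 \<le> Sup T" "Sup T \<le> 1"
      using cSup_upper[OF T] cSup_least[OF T_ne, of 1] by (auto simp: T_def)
    \<comment> \<open>From a point of \<open>C\<close> the segment could be continued a little
      inside \<open>C\<close>, beyond the supremum.\<close>
    have pC: "p \<notin> C"
    proof
      assume p: "p \<in> C"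
      then have "Sup T < 1" using Sup xC by (cases "Sup T = 1") (auto simp: p_def seg_def)
      obtain \<delta> where \<delta>: "\<delta> > 0" "\<And>t. \<bar>t\<bar> < \<delta> \<Longrightarrow> p + t *\<^sub>R (x - c) \<in> C"
        using radial[OF p] by blast
      define e where "e = min (\<delta> / 2) (1 - Sup T)"
      have e: "e > 0" "e < \<delta>" "Sup T + e \<le> 1" using \<delta> \<open>Sup T < 1\<close> by (auto simp: e_def)
      have "seg (Sup T + e) = p + e *\<^sub>R (x - c)"
        by (simp add: p_def seg_def algebra_simps)
      then have "Sup T + e \<in> T" using e Sup \<delta>(2)[of e] by (auto simp: T_def)
      then show False using cSup_upper[OF _ T(2)] e by fastforce
    qed
    have "continuous_on UNIV seg" unfolding seg_def by (intro continuous_intros)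
    then have "seg ` closure T \<subseteq> closure C"
      by (intro image_closure_subset) (auto simp: T_def closure_subset[THEN subsetD] intro: continuous_on_subset)
    then have pcl: "p \<in> closure C" using closure_contains_Sup[OF T_ne T(2)] by (auto simp: p_def)
    have "dist c p = Sup T * dist c x" using Sup
      by (simp add: p_def seg_def dist_norm norm_minus_commute)
    also have "\<dots> \<le> dist c x" using Sup by (simp add: mult_left_le_one_le)
    finally have "p \<in> ball c r" using x by simp
    then obtain \<rho> where \<rho>: "\<rho> > 0" "ball p \<rho> \<subseteq> ball c r" using open_ball openE by blast
    \<comment> \<open>The numerator is the upper bound \<open>M\<close> minus the lower bound on
      \<open>\<Phi>\<close> over \<open>ball c r\<close> given by the subgradient at
      \<open>c\<close>. Around each \<open>f\<close> within \<open>\<rho> / 2\<close> of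
      \<open>p\<close>, a ball of radius \<open>\<rho> / 2\<close> stays in
      \<open>ball p \<rho>\<close>.\<close>
    define K where "K = 2 * (M - (\<Phi> c - norm (D c) * r)) / (\<rho> / 2)"
    have bound: "norm (D f) \<le> K" if f: "f \<in> C" "dist f p < \<rho> / 2" for f
      unfolding K_def
    proof (rule norm_blinfun_le_of_bound_on_ball)
      show "\<rho> / 2 > 0" using \<rho> by simp
      fix w :: 'a assume w: "norm w < \<rho> / 2"
      have "dist p (f + w) \<le> dist p f + norm w" using norm_triangle_ineq4[of "p - f" w]
        by (simp add: dist_norm algebra_simps)
      then have "f + w \<in> ball p \<rho>" using f w by (simp add: dist_commute)
      then have 1: "\<Phi> f + blinfun_apply (D f) w \<le> M" using M[OF f(1), of "f + w"] \<rho> by auto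
      have "f \<in> ball p \<rho>" using f \<rho>(1) by (simp add: dist_commute)
      then have "f \<in> ball c r" using \<rho>(2) by blast
      then have "norm (f - c) < r" by (simp add: dist_norm norm_minus_commute)
      then have "norm (D c) * norm (f - c) \<le> norm (D c) * r" by (intro mult_left_mono) auto
      then have "blinfun_apply (D c) (f - c) \<ge> - (norm (D c) * r)"
        using norm_blinfun[of "D c" "f - c"] by (simp add: abs_le_iff)
      then show "blinfun_apply (D f) w \<le> M - (\<Phi> c - norm (D c) * r)"
        using 1 subgradient_ineq[OF c f(1)] by simp
    qed
    have "\<forall>\<^sub>F f in at p within C. f \<in> C \<and> dist f p < \<rho> / 2"
      using \<rho>(1) unfolding eventually_at by (intro exI[of _ "\<rho> / 2"]) auto
    with blowup_eventually(1)[OF pcl pC, of "K + 1"] have "\<forall>\<^sub>F f in at p within C. False"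
      by eventually_elim (use bound in force)
    then show False using blowup_eventually(2)[OF pcl pC] by simp
  qed
  then show "\<exists>e>0. ball c e \<subseteq> C" using r by blast
qed

end

section \<open>Existence of the Bregman projection\<close>

locale mirror_descent = gateaux_convex C \<Phi> for C :: "'a::banach set" and \<Phi> +
  fixes B0 :: "'a set" and \<mu> :: real
  assumes compact_B0: "compact B0" and convex_B0: "convex B0"
    and B0_closure: "B0 \<subseteq> closure C" and nonempty: "B0 \<inter> C \<noteq> {}"
    and mirror: "mirror_map C \<Phi>"
    and strong: "\<mu> > 0" "strongly_convex_over \<mu> (C \<inter> B0) C \<Phi>"
begin

text \<open>Up to a constant this is the Bregman divergence from
  \<open>mirror_inv C \<Phi> g\<close>, since the gradient there is \<open>g\<close>.\<close>

abbreviation tilted :: "'a dual \<Rightarrow> 'a \<Rightarrow> real" where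
  "tilted g f \<equiv> \<Phi> f - blinfun_apply g f"

text \<open>The supporting affine function at one point \<open>c\<close> is bounded below on the
  bounded set \<open>B0\<close>.\<close>

lemma tilted_bdd_below: "bdd_below (tilted g ` (B0 \<inter> C))"
proof -
  obtain c where c: "c \<in> B0 \<inter> C" using nonempty by blast
  obtain K where K: "\<And>x. x \<in> B0 \<Longrightarrow> norm x \<le> K"
    using compact_imp_bounded[OF compact_B0] unfolding bounded_iff by blast
  have "tilted g f \<ge> tilted g c - norm (D c - g) * (2 * K)" if f: "f \<in> B0 \<inter> C" for f
  proof -
    have "norm (f - c) \<le> 2 * K"
      using K[of f] K[of c] f c norm_triangle_ineq4[of f c] by simp
    then have "norm (D c - g) * norm (f - c) \<le> norm (D c - g) * (2 * K)"
      by (intro mult_left_mono) auto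
    then have "blinfun_apply (D c - g) (f - c) \<ge> - (norm (D c - g) * (2 * K))"
      using norm_blinfun[of "D c - g" "f - c"] by (simp add: abs_le_iff)
    then show ?thesis
      using subgradient_ineq[of c f] c f by (simp add: blinfun.diff_left blinfun.diff_right)
  qed
  then show ?thesis unfolding bdd_below_def by blast
qed

text \<open>
  If a minimizing sequence tended to a point \<open>p\<close> outside \<open>C\<close>, the blow-up would force the slope of
  \<open>\<Phi>\<close> at points close to \<open>p\<close> in the direction of an interior point \<open>c\<close> to be very negative, so
  moving from \<open>p\<close> a little towards \<open>c\<close> would go below the infimum.
\<close>

lemma tilted_has_minimizer:
  "\<exists>p\<in>B0 \<inter> C. \<forall>f\<in>B0 \<inter> C. tilted g p \<le> tilted g f"
proof -
  define m where "m = Inf (tilted g ` (B0 \<inter> C))"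
  have m: "m \<le> tilted g f" if "f \<in> B0 \<inter> C" for f
    unfolding m_def using that tilted_bdd_below by (intro cInf_lower) auto
  have "\<exists>f\<in>B0 \<inter> C. tilted g f < m + 1 / real (Suc n)" for n
  proof (rule ccontr)
    assume "\<not> ?thesis"
    then have "m + 1 / real (Suc n) \<le> m"
      using nonempty by (subst (2) m_def) (intro cInf_greatest, auto simp: not_less)
    then show False by simp
  qed
  then obtain x0 where x0: "\<And>n. x0 n \<in> B0 \<inter> C" "\<And>n. tilted g (x0 n) < m + 1 / real (Suc n)"
    by metis
  obtain p s where p: "p \<in> B0" and s: "strict_mono (s :: nat \<Rightarrow> nat)" "(x0 \<circ> s) \<longlonglongrightarrow> p"
    using compact_B0 x0(1) unfolding compact_def by (metis IntE)
  define x where "x = x0 \<circ> s"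
  have x: "\<And>n. x n \<in> B0 \<inter> C" "x \<longlonglongrightarrow> p" using x0 s by (auto simp: x_def)
  have "(\<lambda>n. m + 1 / real (Suc n)) \<longlonglongrightarrow> m + 0"
    by (intro tendsto_intros LIMSEQ_Suc[OF lim_1_over_n])
  then have lim: "(\<lambda>n. m + 1 / real (Suc (s n))) \<longlonglongrightarrow> m"
    using LIMSEQ_subseq_LIMSEQ[OF _ s(1)] by (simp add: comp_def)
  \<comment> \<open>Supporting affine functions are continuous, so their bounds pass to the limit
    even if \<open>p\<close> is outside \<open>C\<close>, where the value of \<open>\<Phi>\<close>
    is meaningless.\<close>
  have low: "tilted g y + blinfun_apply (D y - g) (p - y) \<le> m" if y: "y \<in> C" for y
  proof (rule LIMSEQ_le[OF _ lim])
    show "(\<lambda>n. tilted g y + blinfun_apply (D y - g) (x n - y)) \<longlonglongrightarrow>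
        tilted g y + blinfun_apply (D y - g) (p - y)"
      by (intro tendsto_intros x)
    have "tilted g y + blinfun_apply (D y - g) (x n - y) \<le> m + 1 / real (Suc (s n))" for n
      using subgradient_ineq[OF y, of "x n"] x(1)[of n] x0(2)[of "s n"]
      by (simp add: x_def blinfun.diff_left blinfun.diff_right)
    then show "\<exists>N. \<forall>n\<ge>N. tilted g y + blinfun_apply (D y - g) (x n - y) \<le> m + 1 / real (Suc (s n))"
      by blast
  qed
  have "p \<in> C"
  proof (rule ccontr)
    assume pC: "p \<notin> C"
    have pcl: "p \<in> closure C" using p B0_closure by blast
    obtain c where c: "c \<in> B0 \<inter> C" using nonempty by blast
    obtain M r where r: "r > 0"
      and M: "\<And>y z. y \<in> C \<Longrightarrow> z \<in> ball c r \<Longrightarrow> \<Phi> y + blinfun_apply (D y) (z - y) \<le> M"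
      using supports_locally_bounded c by blast
    define d where "d = norm (c - p)"
    \<comment> \<open>Chosen so that \<open>norm (D v) \<ge> K\<close> makes \<open>D v - g\<close>
      negative at \<open>c - v\<close>: the terms with \<open>d\<close> absorb the lower bound on
      \<open>\<Phi> v\<close> and the contribution of \<open>g\<close>, and the 1 gives
      strictness.\<close>
    define K where "K = 2 * (M - \<Phi> c + norm (D c) * d + norm g * d + 1) / r"
    define y where "y = (\<lambda>\<delta>. p + \<delta> *\<^sub>R (c - p))"
    have yC: "y \<delta> \<in> C" if "0 < \<delta>" "\<delta> \<le> 1" for \<delta>
      unfolding y_def using convex_open_closure_shrink[OF convex_domain open_domain] c pcl that by blast
    have yB: "y \<delta> \<in> B0" if "0 < \<delta>" "\<delta> \<le> 1" for \<delta>
    proof -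
      have "y \<delta> = (1 - \<delta>) *\<^sub>R p + \<delta> *\<^sub>R c" by (simp add: y_def algebra_simps)
      then show ?thesis using convexD_alt[OF convex_B0 p, of c \<delta>] c that by simp
    qed
    have "filterlim y (at p within C) (at_right 0)"
      unfolding filterlim_at
    proof
      have "(y \<longlongrightarrow> p + 0 *\<^sub>R (c - p)) (at_right 0)"
        unfolding y_def by (intro tendsto_intros)
      then show "(y \<longlongrightarrow> p) (at_right 0)" by simp
      have "\<forall>\<^sub>F \<delta> in at_right 0. (0::real) < \<delta> \<and> \<delta> < 1"
        unfolding eventually_at_right_field by (intro exI[of _ 1]) auto
      then show "\<forall>\<^sub>F \<delta> in at_right 0. y \<delta> \<in> C \<and> y \<delta> \<noteq> p"
        by eventually_elim (use yC pC in force)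
    qed
    then have "\<forall>\<^sub>F \<delta> in at_right 0. K \<le> norm (D (y \<delta>))"
      using blowup_eventually(1)[OF pcl pC] eventually_compose_filterlim by blast
    moreover have "\<forall>\<^sub>F \<delta> in at_right 0. (0::real) < \<delta> \<and> \<delta> < 1"
      unfolding eventually_at_right_field by (intro exI[of _ 1]) auto
    ultimately have "\<forall>\<^sub>F \<delta> in at_right 0. K \<le> norm (D (y \<delta>)) \<and> 0 < \<delta> \<and> \<delta> < 1"
      by eventually_elim simp
    then obtain \<delta> where \<delta>: "K \<le> norm (D (y \<delta>))" "0 < \<delta>" "\<delta> < 1"
      using eventually_happens[of _ "at_right (0::real)"] by auto
    define v where "v = y \<delta>"
    have v: "v \<in> C" "v \<in> B0" using yC yB \<delta> by (auto simp: v_def)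
    have "c - v = (1 - \<delta>) *\<^sub>R (c - p)" by (simp add: v_def y_def algebra_simps)
    then have cv: "norm (c - v) \<le> d" using \<delta> by (simp add: d_def mult_left_le_one_le)
    have nb: "\<bar>blinfun_apply h (c - v)\<bar> \<le> norm h * d" for h :: "'a dual"
      using norm_blinfun[of h "c - v"] mult_left_mono[OF cv, of "norm h"] by simp
    have "norm (D v) \<le> 2 * (M - \<Phi> v - blinfun_apply (D v) (c - v)) / r"
    proof (rule norm_blinfun_le_of_bound_on_ball[OF r])
      fix w :: 'a assume "norm w < r"
      then have "\<Phi> v + blinfun_apply (D v) (c + w - v) \<le> M"
        using M[OF v(1), of "c + w"] by (simp add: dist_norm)
      then show "blinfun_apply (D v) w \<le> M - \<Phi> v - blinfun_apply (D v) (c - v)"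
        by (simp add: blinfun.add_right blinfun.diff_right)
    qed
    with \<delta>(1) have "K \<le> 2 * (M - \<Phi> v - blinfun_apply (D v) (c - v)) / r" by (simp add: v_def)
    then have "M - \<Phi> c + norm (D c) * d + norm g * d + 1 \<le> M - \<Phi> v - blinfun_apply (D v) (c - v)"
      using r by (simp add: K_def divide_le_cancel)
    moreover have "\<Phi> v \<ge> \<Phi> c - norm (D c) * d"
      using subgradient_ineq[of c v] c v nb[of "D c"]
      by (simp add: blinfun.diff_right abs_le_iff)
    ultimately have neg: "blinfun_apply (D v - g) (c - v) < 0"
      using nb[of g] by (simp add: blinfun.diff_left abs_le_iff)
    \<comment> \<open>As \<open>v\<close> lies between \<open>p\<close> and \<open>c\<close>, the
      slope towards \<open>p\<close> is positive, and \<open>low\<close> at \<open>v\<close> puts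
      \<open>tilted g v\<close> below the infimum.\<close>
    have "(1 - \<delta>) *\<^sub>R (p - v) = (- \<delta>) *\<^sub>R (c - v)"
      by (simp add: v_def y_def algebra_simps)
    then have "(1 - \<delta>) * blinfun_apply (D v - g) (p - v) = - \<delta> * blinfun_apply (D v - g) (c - v)"
      by (metis blinfun.scaleR_right real_scaleR_def)
    also have "\<dots> > 0" using neg \<delta> by (simp add: mult_pos_neg)
    finally have "blinfun_apply (D v - g) (p - v) > 0"
      using \<delta> by (simp add: zero_less_mult_iff)
    then show False using low[OF v(1)] m[of v] v by simp
  qed
  moreover have "tilted g p \<le> m" using low[OF \<open>p \<in> C\<close>] by simp
  ultimately show ?thesis using p m by (intro bexI[of _ p]) fastforce+
qed

text \<open>Subgradients filling the dual give existence, their disjointness uniqueness, so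
  \<open>THE\<close> is determined.\<close>

lemma mirror_inv:
  "mirror_inv C \<Phi> g \<in> C" "D (mirror_inv C \<Phi> g) = g"
proof -
  obtain f where f: "f \<in> C" "g \<in> subgradients C \<Phi> f"
    using mirror unfolding mirror_map_def by blast
  have "mirror_inv C \<Phi> g = f"
    unfolding mirror_inv_def
    using f mirror unfolding mirror_map_def by (intro the_equality) blast+
  then show "mirror_inv C \<Phi> g \<in> C" "D (mirror_inv C \<Phi> g) = g"
    using f subgradients_eq by auto
qed

text \<open>\<open>arg_min_on\<close> denotes a minimizer because one exists by
  \<open>tilted_has_minimizer\<close>; the constant \<open>k\<close> does not affect it.\<close>

lemma bregman_proj_minimizes:
  defines "p \<equiv> \<lambda>g. bregman_proj C \<Phi> B0 (mirror_inv C \<Phi> g)"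
  shows "p g \<in> B0 \<inter> C" "f \<in> B0 \<inter> C \<Longrightarrow> tilted g (p g) \<le> tilted g f"
proof -
  define b where "b = (\<lambda>f. bregman C \<Phi> f (mirror_inv C \<Phi> g))"
  define k where "k = blinfun_apply g (mirror_inv C \<Phi> g) - \<Phi> (mirror_inv C \<Phi> g)"
  have k: "b f = tilted g f + k" for f
    by (simp add: b_def k_def bregman_def mirror_inv blinfun.diff_right)
  obtain q where q: "q \<in> B0 \<inter> C" "\<And>f. f \<in> B0 \<inter> C \<Longrightarrow> tilted g q \<le> tilted g f"
    using tilted_has_minimizer by blast
  have "p g \<in> B0 \<inter> C \<and> (\<forall>f\<in>B0 \<inter> C. tilted g (p g) \<le> tilted g f)"
    unfolding p_def bregman_proj_def arg_min_on_def b_def[symmetric]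
    by (rule arg_minI[of _ q]) (use q in \<open>auto simp: k not_less\<close>)
  then show "p g \<in> B0 \<inter> C" "f \<in> B0 \<inter> C \<Longrightarrow> tilted g (p g) \<le> tilted g f" by auto
qed

section \<open>Regret of mirror descent\<close>

text \<open>The subgradient from strong convexity can only be \<open>D p\<close>, and first-order
  optimality along segments in \<open>B0 \<inter> C\<close> makes \<open>D p - g\<close> nonnegative
  at \<open>f - p\<close>.\<close>

lemma tilted_quadratic_growth:
  assumes p: "p \<in> B0 \<inter> C" "\<And>f. f \<in> B0 \<inter> C \<Longrightarrow> tilted g p \<le> tilted g f"
    and f: "f \<in> B0 \<inter> C"
  shows "tilted g p + \<mu> / 2 * (norm (f - p))\<^sup>2 \<le> tilted g f"
proof -
  have "\<Phi> f - \<Phi> p \<ge> blinfun_apply (D p) (f - p) + \<mu> / 2 * (norm (f - p))\<^sup>2"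
  proof -
    obtain s where "s \<in> subgradients C \<Phi> p"
      "\<forall>f\<in>C \<inter> B0. \<Phi> f - \<Phi> p \<ge> blinfun_apply s (f - p) + \<mu> / 2 * (norm (f - p))\<^sup>2"
      using strong(2) p(1) unfolding strongly_convex_over_def by blast
    then show ?thesis using f p(1) subgradients_eq[of p] by auto
  qed
  moreover have "blinfun_apply g (f - p) \<le> blinfun_apply (D p) (f - p)"
  proof (rule tendsto_lowerbound[OF has_gateaux_derivative_at_right[OF has_gateaux_derivative_D]])
    have "blinfun_apply g (f - p) \<le> (\<Phi> (p + t *\<^sub>R (f - p)) - \<Phi> p) / t" if t: "0 < t" "t < 1" for t
    proof -
      have eq: "p + t *\<^sub>R (f - p) = (1 - t) *\<^sub>R p + t *\<^sub>R f" by (simp add: algebra_simps)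
      have "p + t *\<^sub>R (f - p) \<in> B0 \<inter> C"
        unfolding eq using convexD_alt[OF convex_Int[OF convex_B0 convex_domain] p(1) f] t by simp
      then have "t * blinfun_apply g (f - p) \<le> \<Phi> (p + t *\<^sub>R (f - p)) - \<Phi> p"
        using p(2) by (fastforce simp: blinfun.add_right blinfun.scaleR_right)
      then show ?thesis using t by (simp add: field_simps)
    qed
    then show "\<forall>\<^sub>F t in at_right 0. blinfun_apply g (f - p) \<le> (\<Phi> (p + t *\<^sub>R (f - p)) - \<Phi> p) / t"
      by (auto simp: eventually_at_right_field intro!: exI[of _ 1])
  qed (use p in auto)
  ultimately show ?thesis by (simp add: blinfun.diff_right)
qed

text \<open>The potential \<open>V\<^sub>t\<close>: the excess of the divergence from the
  unprojected point at \<open>u\<close> over its minimum on \<open>B0 \<inter> C\<close>.\<close>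

definition gap :: "'a dual \<Rightarrow> 'a \<Rightarrow> real" where
  "gap g u = tilted g u - tilted g (bregman_proj C \<Phi> B0 (mirror_inv C \<Phi> g))"

lemma gap_nonneg: "u \<in> B0 \<inter> C \<Longrightarrow> gap g u \<ge> 0"
  using bregman_proj_minimizes(2) by (simp add: gap_def)

text \<open>The dual iterate is not reset to the gradient at the projected point, as in dual
  averaging. The change of the potential is an exact identity, in which quadratic growth pays for
  the move from \<open>p\<close> to \<open>q\<close>.\<close>

lemma gap_step:
  fixes g s :: "'a dual"
  assumes u: "u \<in> B0 \<inter> C" and \<eta>: "\<eta> > 0" and s: "norm s \<le> L"
  defines "p \<equiv> bregman_proj C \<Phi> B0 (mirror_inv C \<Phi> g)"
  shows "gap (g - \<eta> *\<^sub>R s) u \<le> gap g u - \<eta> * blinfun_apply s (p - u) + \<eta>\<^sup>2 * (L\<^sup>2 / (2 * \<mu>))"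
proof -
  define q where "q = bregman_proj C \<Phi> B0 (mirror_inv C \<Phi> (g - \<eta> *\<^sub>R s))"
  define d where "d = norm (q - p)"
  have q: "q \<in> B0 \<inter> C" unfolding q_def by (rule bregman_proj_minimizes)
  have growth: "tilted g p + \<mu> / 2 * d\<^sup>2 \<le> tilted g q"
    unfolding d_def p_def by (rule tilted_quadratic_growth[OF bregman_proj_minimizes q])
  have "blinfun_apply s (p - q) \<le> norm s * d"
    using norm_blinfun[of s "p - q"] by (simp add: d_def norm_minus_commute abs_le_iff)
  also have "\<dots> \<le> L * d" using s by (intro mult_right_mono) (auto simp: d_def)
  finally have "\<eta> * blinfun_apply s (p - q) \<le> \<eta> * (L * d)" using \<eta> by simp
  \<comment> \<open>Completing the square in \<open>d\<close>.\<close>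
  moreover have "\<eta> * (L * d) - \<mu> / 2 * d\<^sup>2 \<le> \<eta>\<^sup>2 * (L\<^sup>2 / (2 * \<mu>))"
  proof -
    have "0 \<le> (\<eta> * L - \<mu> * d)\<^sup>2 / (2 * \<mu>)" using strong(1) by simp
    also have "\<dots> = \<eta>\<^sup>2 * (L\<^sup>2 / (2 * \<mu>)) - \<eta> * (L * d) + \<mu> / 2 * d\<^sup>2"
      using strong(1) by (simp add: field_simps power2_eq_square)
    finally show ?thesis by simp
  qed
  moreover have "gap (g - \<eta> *\<^sub>R s) u = gap g u - \<eta> * blinfun_apply s (p - u)
      + \<eta> * blinfun_apply s (p - q) - (tilted g q - tilted g p)"
    by (simp add: gap_def flip: p_def q_def)
      (simp add: blinfun.diff_left blinfun.diff_right blinfun.scaleR_left algebra_simps)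
  ultimately show ?thesis using growth by simp
qed

text \<open>The steps telescope and the final gap is dropped as nonnegative. The start
  \<open>a\<close> is free because regret over suffixes is needed.\<close>

lemma regret_bound:
  assumes run: "projected_mirror_descent Loss C \<Phi> B0 \<eta> g f"
    and lip: "lipschitz_functional L Loss" and \<eta>: "\<eta> > 0" and u: "u \<in> B0 \<inter> C" and "a \<le> T"
  shows "(\<Sum>k=a..T. Loss (f k) - Loss u) \<le> gap (g a) u / \<eta> + real (T + 1 - a) * (\<eta> * (L\<^sup>2 / (2 * \<mu>)))"
proof -
  define e where "e = \<eta>\<^sup>2 * (L\<^sup>2 / (2 * \<mu>))"
  have one_step: "\<eta> * (Loss (f k) - Loss u) \<le> gap (g k) u - gap (g (Suc k)) u + e" for k
  proof -
    obtain s where s: "s \<in> subgradients UNIV Loss (f k)" "g (Suc k) = g k - \<eta> *\<^sub>R s"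
      and f: "f k = bregman_proj C \<Phi> B0 (mirror_inv C \<Phi> (g k))"
      using run unfolding projected_mirror_descent_def by blast
    have "norm s \<le> L" using lip s unfolding lipschitz_functional_def by blast
    then have "\<eta> * blinfun_apply s (f k - u) \<le> gap (g k) u - gap (g (Suc k)) u + e"
      using gap_step[OF u \<eta>, of s L "g k"] by (simp add: s(2) e_def flip: f)
    moreover have "Loss (f k) - Loss u \<le> blinfun_apply s (f k - u)"
      using s(1) unfolding subgradients_def by (simp add: blinfun.diff_right) smt
    ultimately show ?thesis using \<eta> by (smt (verit) mult_left_mono)
  qed
  have "\<eta> * (\<Sum>k=a..T. Loss (f k) - Loss u) \<le> gap (g a) u - gap (g (Suc T)) u + real (T + 1 - a) * e"
    using \<open>a \<le> T\<close>
  proof (induction T rule: dec_induct)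
    case base
    show ?case using one_step[of a] by simp
  next
    case (step n)
    have eq: "real (Suc n + 1 - a) = real (n + 1 - a) + 1" using step.hyps by simp
    show ?case unfolding eq using step.IH one_step[of "Suc n"] step.hyps
      by (simp add: algebra_simps)
  qed
  also have "\<dots> \<le> gap (g a) u + real (T + 1 - a) * e" using gap_nonneg[OF u] by simp
  also have "\<dots> = \<eta> * (gap (g a) u / \<eta> + real (T + 1 - a) * (\<eta> * (L\<^sup>2 / (2 * \<mu>))))"
    using \<eta> by (simp add: e_def distrib_left power2_eq_square)
  finally show ?thesis using \<eta> by simp
qed

end

section \<open>From regret to the last iterate\<close>

text \<open>Suffixes grow backwards from the last value. A suffix average exceeds its first term by
  at most \<open>e\<close>, so prepending that term lowers the average by at most
  \<open>e / (j + 1)\<close>; these losses sum to the harmonic number.\<close>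

lemma last_le_average_plus_harm:
  fixes l :: "nat \<Rightarrow> real"
  assumes "\<And>a. a \<le> T \<Longrightarrow> (\<Sum>k=a..T. l k - l a) \<le> real (T + 1 - a) * e"
  shows "l T \<le> (\<Sum>k=0..T. l k) / real (T + 1) + e * harm T"
proof -
  have "l T \<le> (\<Sum>k=T-j..T. l k) / real (j + 1) + e * harm j" if "j \<le> T" for j
    using that
  proof (induction j)
    case 0
    show ?case by (simp add: harm_expand)
  next
    case (Suc j)
    define a where "a = T - Suc j"
    define S where "S = (\<Sum>k=a..T. l k)"
    define S' where "S' = (\<Sum>k=T-j..T. l k)"
    have aT: "a \<le> T" "T - j = Suc a" "T + 1 - a = j + 2" using Suc.prems by (auto simp: a_def)
    have card: "card {a..T} = j + 2" using aT(3) by simp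
    have S: "S = l a + S'" unfolding S_def S'_def aT(2) using aT(1) by (rule sum.atLeast_Suc_atMost)
    have "S - real (j + 2) * l a \<le> real (j + 2) * e"
      using assms[OF aT(1)] card unfolding aT(3) S_def sum_subtractf
      by (simp del: card_atLeastAtMost)
    then have "real (j + 2) * S' \<le> real (j + 1) * S + real (j + 2) * e"
      by (simp add: S algebra_simps)
    then have "real (j + 2) * S' / (real (j + 1) * real (j + 2))
        \<le> (real (j + 1) * S + real (j + 2) * e) / (real (j + 1) * real (j + 2))"
      by (rule divide_right_mono) simp
    then have "S' / real (j + 1) \<le> S / real (j + 2) + e / real (j + 1)"
      unfolding add_divide_distrib by (simp del: of_nat_add of_nat_Suc)
    then show ?case using Suc
      by (simp add: harm_Suc S_def S'_def a_def algebra_simps divide_inverse)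
  qed
  from this[of T] show ?thesis by simp
qed

lemma one_plus_harm_over_sqrt_soft_bigo:
  "(\<lambda>t. K * (1 + harm t) / sqrt (real t + 1)) \<in> soft_bigo (\<lambda>t. 1 / sqrt (real t))"
proof -
  have "(\<lambda>t. (1 + harm t) / sqrt (real t + 1)) \<in> O(\<lambda>t. (2 + ln (real t)) / sqrt (real t + 1))"
  proof (rule landau_o.big_mono)
    have "norm ((1 + harm t) / sqrt (real t + 1)) \<le> norm ((2 + ln (real t)) / sqrt (real t + 1))"
      if t: "t \<ge> 1" for t
    proof -
      \<comment> \<open>\<open>harm n - ln n\<close> decreases from its value 1 at
        \<open>n = 1\<close>.\<close>
      have "0 \<le> 1 + (harm t :: real)" "1 + harm t \<le> 2 + ln (real t)"
        using euler_mascheroni_sequence_decreasing[of 1 t] t harm_nonneg[of t, where 'a = real]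
        by (simp_all add: harm_expand)
      then show ?thesis by (simp add: divide_right_mono)
    qed
    then show "\<forall>\<^sub>F t in sequentially.
        norm ((1 + harm t) / sqrt (real t + 1)) \<le> norm ((2 + ln (real t)) / sqrt (real t + 1))"
      unfolding eventually_sequentially by blast
  qed
  also have "(\<lambda>t. (2 + ln (real t)) / sqrt (real t + 1)) \<in> O(\<lambda>t. 1 / sqrt (real t) * ln (real t) ^ 1)"
    by real_asymp
  finally have "(\<lambda>t. K * ((1 + harm t) / sqrt (real t + 1))) \<in> O(\<lambda>t. 1 / sqrt (real t) * ln (real t) ^ 1)"
    by (cases "K = 0") (simp, simp only: landau_o.big.cmult_in_iff not_False_eq_True)
  then show ?thesis unfolding soft_bigo_def by (auto intro!: exI[of _ 1])
qed

section \<open>Learning rate and convergence\<close>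

theorem theorem25:
  fixes B0 C :: "'a::banach set" and Loss \<Phi> :: "'a \<Rightarrow> real" and L \<mu> R :: real
  assumes reflexive: "reflexive_space TYPE('a)"
    and B0: "compact B0" "convex B0"
    and loss: "convex_on UNIV Loss" "lipschitz_functional L Loss"
    and C: "convex C" "B0 \<subseteq> closure C"
    and proper: "C \<noteq> {}"
    and mirror: "mirror_map C \<Phi>"
    and gateaux: "gateaux_differentiable_on C \<Phi>"
    and strong: "\<mu> > 0" "strongly_convex_over \<mu> (C \<inter> B0) C \<Phi>"
    and blowup: "grad_blowup_at_boundary C \<Phi>"
    and R: "B0 \<inter> C \<noteq> {}"
      "bdd_above {\<bar>\<Phi> f - \<Phi> f'\<bar> | f f'. f \<in> B0 \<inter> C \<and> f' \<in> B0 \<inter> C}"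
      "R\<^sup>2 = Sup {\<bar>\<Phi> f - \<Phi> f'\<bar> | f f'. f \<in> B0 \<inter> C \<and> f' \<in> B0 \<inter> C}"
  shows "\<exists>\<eta>::nat \<Rightarrow> real. (\<forall>t. \<eta> t > 0) \<and>
    (\<forall>fstar g0. is_arg_min Loss (\<lambda>f. f \<in> B0) fstar \<longrightarrow>
      (\<exists>r \<in> soft_bigo (\<lambda>t. 1 / sqrt (real t)).
        \<forall>t g f. projected_mirror_descent Loss C \<Phi> B0 (\<eta> t) g f \<and> g 0 = g0 \<longrightarrow>
          f t \<in> B0 \<and> Loss (f t) - Loss fstar \<le> r t))"
proof -
  interpret mirror_descent C \<Phi> B0 \<mu>
  proof unfold_locales
    show "convex_on C \<Phi>"
      using mirror by (simp add: mirror_map_def strictly_convex_on_imp_convex_on)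
  qed (use assms in auto)
  \<comment> \<open>For horizon \<open>t\<close> there are \<open>t + 1\<close> iterates; this rate
    balances \<open>V / ((t + 1) * \<eta>)\<close> against \<open>\<eta> * G\<close> and is defined
    at \<open>t = 0\<close>.\<close>
  define \<eta> where "\<eta> = (\<lambda>t::nat. 1 / sqrt (real t + 1))"
  have \<eta>: "\<eta> t > 0" for t by (simp add: \<eta>_def)
  define G where "G = L\<^sup>2 / (2 * \<mu>)"
  have "\<exists>r \<in> soft_bigo (\<lambda>t. 1 / sqrt (real t)).
        \<forall>t g f. projected_mirror_descent Loss C \<Phi> B0 (\<eta> t) g f \<and> g 0 = g0 \<longrightarrow>
          f t \<in> B0 \<and> Loss (f t) - Loss fstar \<le> r t"
    if fstar: "is_arg_min Loss (\<lambda>f. f \<in> B0) fstar" for fstar g0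
  proof -
    obtain N where N: "\<And>x. x \<in> B0 \<Longrightarrow> norm x \<le> N"
      using compact_imp_bounded[OF B0(1)] unfolding bounded_iff by blast
    \<comment> \<open>Bounds the initial gap independently of \<open>u\<close>:
      \<open>R\<^sup>2\<close> controls the difference in \<open>\<Phi>\<close>, and
      \<open>2 * N\<close> the diameter of \<open>B0\<close>.\<close>
    define V where "V = R\<^sup>2 + norm g0 * (2 * N)"
    have gap_V: "gap g0 u \<le> V" if u: "u \<in> B0 \<inter> C" for u
    proof -
      define p where "p = bregman_proj C \<Phi> B0 (mirror_inv C \<Phi> g0)"
      have p: "p \<in> B0 \<inter> C" unfolding p_def by (rule bregman_proj_minimizes)
      have "\<bar>\<Phi> u - \<Phi> p\<bar> \<le> R\<^sup>2"
        unfolding R(3) using u p by (intro cSup_upper R(2)) blast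
      moreover have "norm (p - u) \<le> 2 * N"
        using N[of u] N[of p] u p norm_triangle_ineq4[of p u] by simp
      then have "blinfun_apply g0 (p - u) \<le> norm g0 * (2 * N)"
        using norm_blinfun[of g0 "p - u"] mult_left_mono[of "norm (p - u)" "2 * N" "norm g0"]
        by (simp add: abs_le_iff)
      ultimately show ?thesis by (simp add: gap_def V_def blinfun.diff_right flip: p_def)
    qed
    \<comment> \<open>As \<open>V \<ge> 0\<close>, the bound \<open>V + G + G * harm t\<close>
      obtained below is at most \<open>K * (1 + harm t)\<close>.\<close>
    define K where "K = V + G"
    define r where "r = (\<lambda>t. K * (1 + harm t) / sqrt (real t + 1))"
    have "V \<ge> 0" using gap_V gap_nonneg nonempty order_trans by blast
    have main: "f t \<in> B0 \<and> Loss (f t) - Loss fstar \<le> r t"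
      if run: "projected_mirror_descent Loss C \<Phi> B0 (\<eta> t) g f" and g0: "g 0 = g0" for t g f
    proof
      have f: "f k = bregman_proj C \<Phi> B0 (mirror_inv C \<Phi> (g k))" for k
        using run unfolding projected_mirror_descent_def by blast
      have fS: "f k \<in> B0 \<inter> C" for k unfolding f by (rule bregman_proj_minimizes)
      then show "f t \<in> B0" by blast
      note regret = regret_bound[OF run loss(2) \<eta>, folded G_def]
      have "(\<Sum>k=a..t. Loss (f k) - Loss (f a)) \<le> real (t + 1 - a) * (\<eta> t * G)" if "a \<le> t" for a
        using regret[OF fS that, of a] by (simp add: gap_def f)
      note last = last_le_average_plus_harm[of t "\<lambda>k. Loss (f k)", OF this]
      \<comment> \<open>The gap is controlled only at points of \<open>C\<close>, so
        \<open>fstar\<close> itself is reached by a limit afterwards.\<close>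
      have near: "Loss (f t) \<le> Loss u + r t" if u: "u \<in> B0 \<inter> C" for u
      proof -
        define q where "q = sqrt (real t + 1)"
        have q: "q > 0" "real t + 1 = q * q" by (auto simp: q_def)
        have \<eta>_q: "\<eta> t = 1 / q" by (simp add: \<eta>_def q_def)
        have "(\<Sum>k=0..t. Loss (f k)) - (q * q) * Loss u = (\<Sum>k=0..t. Loss (f k) - Loss u)"
          by (simp add: sum_subtractf flip: q(2))
        also have "\<dots> \<le> gap g0 u / \<eta> t + (q * q) * (\<eta> t * G)"
          using regret[OF u, of 0 t] by (simp add: g0 add.commute flip: q(2))
        also have "\<dots> \<le> V * q + q * G"
          using gap_V[OF u] q(1) by (simp add: \<eta>_q mult_right_mono)
        finally have "(\<Sum>k=0..t. Loss (f k)) \<le> (q * q) * (Loss u + V / q + G / q)"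
          using q(1) by (simp add: algebra_simps)
        then have "(\<Sum>k=0..t. Loss (f k)) / (q * q) \<le> Loss u + V / q + G / q"
          using q(1) by (simp add: pos_divide_le_eq mult.commute)
        with last have "Loss (f t) \<le> Loss u + (V + G + G * harm t) / q"
          by (simp add: \<eta>_q add.commute add_divide_distrib flip: q(2))
        also have "\<dots> \<le> Loss u + r t"
          using q \<open>V \<ge> 0\<close> harm_nonneg[of t, where 'a = real]
          by (simp add: r_def K_def q_def[symmetric] divide_right_mono algebra_simps)
        finally show ?thesis .
      qed
      obtain c where c: "c \<in> B0 \<inter> C" using nonempty by blast
      have fs: "fstar \<in> B0" using fstar by (simp add: is_arg_min_def)
      have "Loss (f t) \<le> Loss fstar + r t"
      proof (rule tendsto_lowerbound)
        show "((\<lambda>e. (1 - e) * Loss fstar + e * Loss c + r t) \<longlongrightarrow> Loss fstar + r t) (at_right 0)"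
          by (rule tendsto_eq_rhs) (rule tendsto_intros | simp)+
        have "Loss (f t) \<le> (1 - e) * Loss fstar + e * Loss c + r t" if e: "0 < e" "e < 1" for e
        proof -
          have eq: "fstar + e *\<^sub>R (c - fstar) = (1 - e) *\<^sub>R fstar + e *\<^sub>R c"
            by (simp add: algebra_simps)
          have "(1 - e) *\<^sub>R fstar + e *\<^sub>R c \<in> B0"
            using convexD_alt[OF B0(2) fs, of c e] c e by simp
          moreover have "(1 - e) *\<^sub>R fstar + e *\<^sub>R c \<in> C"
            using convex_open_closure_shrink[OF C(1) open_domain, of c fstar e] c C(2) fs e
            by (auto simp: eq)
          ultimately have "Loss (f t) \<le> Loss ((1 - e) *\<^sub>R fstar + e *\<^sub>R c) + r t"
            using near by blast
          then show ?thesis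
            using convex_onD[OF loss(1), of e fstar c] e by simp
        qed
        then show "\<forall>\<^sub>F e in at_right 0. Loss (f t) \<le> (1 - e) * Loss fstar + e * Loss c + r t"
          by (auto simp: eventually_at_right_field intro!: exI[of _ 1])
      qed simp
      then show "Loss (f t) - Loss fstar \<le> r t" by simp
    qed
    show ?thesis
    proof (rule bexI)
      show "r \<in> soft_bigo (\<lambda>t. 1 / sqrt (real t))"
        unfolding r_def by (rule one_plus_harm_over_sqrt_soft_bigo)
    qed (use main in blast)
  qed
  then show ?thesis using \<eta> by blast
qed

end
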